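(* Let $L\subseteq\{0,1\}^*$ be a 0-1-symmetric language that contains either both $1001$ and $0110$ or both $1010$ and $0101$, but does not contain all four of these words. Then $\mathcal{G}_L$ contains all cographs.
   Context: All graphs are finite, simple, undirected, with nonempty vertex sets, and graph classes are considered up to isomorphism. The class of cographs is the smallest class of graphs containing the one-vertex graph $K_1$ and closed under disjoint union and under join (the join of vertex-disjoint graphs $G_1,G_2$ is their disjoint union plus all edges between a vertex of $G_1$ and a vertex of $G_2$). For $w\in\{0,1\}^*$ let $\widetilde{w}$ be obtained from $w$ by exchanging the letters 0 and 1; a language $L\subseteq\{0,1\}^*$ is 0-1-symmetric if $L=\{\widetilde w : w\in L\}$. For an alphabet $V$ and distinct $u,v\in V$, $h_{u,v}:V^*\to\{0,1\}^*$ is the monoid morphism with $u\mapsto 0$, $v\mapsto 1$ and $x\mapsto\lambda$ (empty word) for all other letters $x$. For a 0-1-symmetric $L$ and a nonempty word $w$ whose set of occurring letters is $V$, $G(L,w)$ is the graph with vertex set $V$ in which distinct $u,v$ are adjacent iff $h_{u,v}(w)\in L$. A graph is $L$-representable if it is isomorphic to some $G(L,w)$, and $\mathcal{G}_L$ denotes the class of all $L$-representable graphs. *)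

theory Defs
  imports
    "HOL-Library.Z2"
    "Graph_Theory.Pair_Digraph"
    "Graph_Theory.Digraph_Isomorphism"
begin

text \<open>
  Finite simple undirected graphs are the loop-free symmetric finite digraphs \<open>pair_graph\<close>: an
  undirected edge between \<open>u\<close> and \<open>v\<close> is the pair of arcs \<open>(u, v)\<close>, \<open>(v, u)\<close>. Note that
  \<open>pair_graph\<close> itself allows an empty vertex set.
\<close>

definition disjoint_union ::
    "'a pair_pre_digraph \<Rightarrow> 'a pair_pre_digraph \<Rightarrow> 'a pair_pre_digraph" where
  "disjoint_union G H = \<lparr>pverts = pverts G \<union> pverts H, parcs = parcs G \<union> parcs H\<rparr>"

definition graph_join ::
    "'a pair_pre_digraph \<Rightarrow> 'a pair_pre_digraph \<Rightarrow> 'a pair_pre_digraph" where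
  "graph_join G H =
    \<lparr>pverts = pverts G \<union> pverts H,
     parcs = parcs G \<union> parcs H \<union> pverts G \<times> pverts H \<union> pverts H \<times> pverts G\<rparr>"

text \<open>
  Every one-vertex graph on the vertex type is admitted in the base case, so the class is
  closed under isomorphism.
\<close>

inductive cograph :: "'a pair_pre_digraph \<Rightarrow> bool" where
  single: "cograph \<lparr>pverts = {v}, parcs = {}\<rparr>"
| union: "\<lbrakk>cograph G; cograph H; pverts G \<inter> pverts H = {}\<rbrakk> \<Longrightarrow> cograph (disjoint_union G H)"
| join: "\<lbrakk>cograph G; cograph H; pverts G \<inter> pverts H = {}\<rbrakk> \<Longrightarrow> cograph (graph_join G H)"

definition flip :: "bit list \<Rightarrow> bit list" where
  "flip = map (\<lambda>b. if b = 0 then 1 else 0)"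

definition symmetric01 :: "bit list set \<Rightarrow> bool" where
  "symmetric01 L \<longleftrightarrow> L = {flip w | w. w \<in> L}"

text \<open>The morphism \<open>h\<^bsub>u,v\<^esub>\<close>; meaningful for \<open>u \<noteq> v\<close>.\<close>

definition h_proj :: "'a \<Rightarrow> 'a \<Rightarrow> 'a list \<Rightarrow> bit list" where
  "h_proj u v w = concat (map (\<lambda>x. if x = u then [0] else if x = v then [1] else []) w)"

definition word_graph :: "bit list set \<Rightarrow> 'a list \<Rightarrow> 'a pair_pre_digraph" where
  "word_graph L w =
    \<lparr>pverts = set w,
     parcs = {(u, v). u \<in> set w \<and> v \<in> set w \<and> u \<noteq> v \<and> h_proj u v w \<in> L}\<rparr>"

text \<open>
  Alphabets are finite, so words over \<^typ>\<open>nat\<close> cover all of them up to renaming of letters.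
\<close>

definition representable :: "bit list set \<Rightarrow> 'a pair_pre_digraph \<Rightarrow> bool" where
  "representable L G \<longleftrightarrow>
    (\<exists>w :: nat list. w \<noteq> [] \<and> digraph_iso (with_proj G) (with_proj (word_graph L w)))"

definition represented_graphs :: "bit list set \<Rightarrow> 'a pair_pre_digraph set" where
  "represented_graphs L = {G. representable L G}"

lemma cograph_pair_graph:
  assumes "cograph G"
  shows "pair_graph G \<and> pverts G \<noteq> {}"
proof -
  have "finite (pverts G) \<and> pverts G \<noteq> {} \<and> parcs G \<subseteq> pverts G \<times> pverts G \<and>
      sym (parcs G) \<and> irrefl (parcs G)"
    using assms
  proof induction
    case (single v)
    then show ?case by (auto simp: sym_def irrefl_def)
  next
    case (union G H)
    then show ?case
      unfolding disjoint_union_def sym_def irrefl_def by simp blast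
  next
    case (join G H)
    then show ?case
      unfolding graph_join_def sym_def irrefl_def by simp blast
  qed
  then have "finite (pverts G)" "pverts G \<noteq> {}" "parcs G \<subseteq> pverts G \<times> pverts G"
      "finite (parcs G)" "sym (parcs G)" "irrefl (parcs G)"
    by (auto intro: finite_subset)
  then show ?thesis
    by (auto intro!: pair_graph.intro pair_digraph.intro pair_pseudo_graph.intro
        pair_fin_digraph.intro pair_sym_digraph.intro pair_loopfree_digraph.intro
        pair_wf_digraph.intro pair_fin_digraph_axioms.intro pair_sym_digraph_axioms.intro
        pair_loopfree_digraph_axioms.intro simp: symmetric_def irrefl_def)
qed

lemma h_proj_swap:
  assumes "u \<noteq> v"
  shows "h_proj v u w = flip (h_proj u v w)"
  using assms by (induction w) (auto simp: h_proj_def flip_def)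

lemma word_graph_pair_graph:
  assumes "symmetric01 L"
  shows "pair_graph (word_graph L w)"
proof -
  have flip_in: "flip x \<in> L" if "x \<in> L" for x
    using assms that unfolding symmetric01_def by blast
  have "finite (parcs (word_graph L w))"
    by (rule finite_subset[of _ "set w \<times> set w"]) (auto simp: word_graph_def)
  moreover have "sym (parcs (word_graph L w))"
    unfolding sym_def word_graph_def by simp (metis flip_in h_proj_swap)
  ultimately show ?thesis
    by (auto intro!: pair_graph.intro pair_digraph.intro pair_pseudo_graph.intro
        pair_fin_digraph.intro pair_sym_digraph.intro pair_loopfree_digraph.intro
        pair_wf_digraph.intro pair_fin_digraph_axioms.intro pair_sym_digraph_axioms.intro
        pair_loopfree_digraph_axioms.intro simp: symmetric_def word_graph_def)
qed

end

theory Submission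
  imports Defs
begin

text \<open>
  Let every letter occur exactly twice, in a word \<open>p @ q\<close> made of two orderings of the vertex
  set. The projection to two letters is then \<open>0101\<close> or \<open>1010\<close> if \<open>p\<close> and \<open>q\<close> order them alike, and
  \<open>0110\<close> or \<open>1001\<close> otherwise, and by symmetry of \<open>L\<close> exactly one of these two pairs of words lies
  in \<open>L\<close>. So it suffices that in a cograph adjacency can be encoded by agreement of two orderings,
  and also by disagreement. Concatenating the orderings of the two parts as \<open>p1 p2\<close>, \<open>q1 q2\<close>
  makes all pairs between the parts agree, and \<open>p1 p2\<close>, \<open>q2 q1\<close> makes all of them disagree.
\<close>

lemma h_proj_append: "h_proj u v (xs @ ys) = h_proj u v xs @ h_proj u v ys"
  by (simp add: h_proj_def)

lemma h_proj_notin: "u \<notin> set w \<Longrightarrow> v \<notin> set w \<Longrightarrow> h_proj u v w = []"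
  by (auto simp: h_proj_def)

lemma h_proj_fst:
  "distinct w \<Longrightarrow> u \<in> set w \<Longrightarrow> v \<notin> set w \<Longrightarrow> h_proj u v w = [0]"
proof (induction w)
  case (Cons x w)
  then show ?case
    using h_proj_notin[of u w v] by (auto simp: h_proj_def)
qed simp

lemma h_proj_snd:
  assumes "distinct w" "u \<notin> set w" "v \<in> set w"
  shows "h_proj u v w = [1]"
proof -
  from assms have "h_proj v u w = [0]" "v \<noteq> u"
    by (auto intro: h_proj_fst)
  then show ?thesis
    using h_proj_swap[of v u w] by (simp add: flip_def)
qed

lemma h_proj_map:
  assumes "inj_on f A" "u \<in> A" "v \<in> A" "set w \<subseteq> A"
  shows "h_proj (f u) (f v) (map f w) = h_proj u v w"
  using assms by (induction w) (auto simp: h_proj_def inj_on_eq_iff)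

text \<open>The Boolean \<open>c\<close> tells whether agreement or disagreement of \<open>p\<close> and \<open>q\<close> encodes adjacency.\<close>

definition realizes :: "bool \<Rightarrow> 'a list \<Rightarrow> 'a list \<Rightarrow> 'a pair_pre_digraph \<Rightarrow> bool" where
  "realizes c p q G \<longleftrightarrow>
    distinct p \<and> distinct q \<and> set p = pverts G \<and> set q = pverts G \<and>
    (\<forall>u\<in>pverts G. \<forall>v\<in>pverts G. u \<noteq> v \<longrightarrow>
      h_proj u v p \<in> {[0,1], [1,0]} \<and> h_proj u v q \<in> {[0,1], [1,0]} \<and>
      ((u, v) \<in> parcs G \<longleftrightarrow> (h_proj u v p = h_proj u v q) = c))"

lemma cograph_arcs:
  assumes "cograph G" "(u, v) \<in> parcs G"
  shows "u \<in> pverts G" "v \<in> pverts G" "u \<noteq> v"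
proof -
  interpret pair_graph G
    using cograph_pair_graph[OF assms(1)] by simp
  show "u \<in> pverts G" "v \<in> pverts G"
    using assms(2) arc_fst_in_verts[of "(u, v)"] arc_snd_in_verts[of "(u, v)"] by auto
  show "u \<noteq> v"
    using assms(2) pair_no_loops[of "(u, v)"] by auto
qed

text \<open>A pair split between \<open>G\<close> and \<open>H\<close> must be adjacent iff
  \<open>a\<close>. Under encoding \<open>c\<close> its two projections must therefore agree exactly
  when \<open>a = c\<close>, which decides whether the second ordering keeps or swaps the order of
  the parts.\<close>

lemma realizes_combine:
  fixes a c :: bool
  defines "K \<equiv> \<lambda>G H. if a then graph_join G H else disjoint_union G H"
  assumes "cograph G" "cograph H" and disj: "pverts G \<inter> pverts H = {}"
    and G: "realizes c p1 q1 G" and H: "realizes c p2 q2 H"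
  shows "realizes c (p1 @ p2) (if a = c then q1 @ q2 else q2 @ q1) (K G H)"
proof -
  let ?q = "if a = c then q1 @ q2 else q2 @ q1"
  have sets: "distinct p1" "distinct p2" "distinct q1" "distinct q2" "set p1 = pverts G"
      "set q1 = pverts G" "set p2 = pverts H" "set q2 = pverts H"
    using G H by (auto simp: realizes_def)
  note arcs = cograph_arcs[OF assms(2)] cograph_arcs[OF assms(3)]
  have verts: "pverts (K G H) = pverts G \<union> pverts H"
    by (simp add: K_def graph_join_def disjoint_union_def)
  have "h_proj u v (p1 @ p2) \<in> {[0,1], [1,0]} \<and> h_proj u v ?q \<in> {[0,1], [1,0]} \<and>
      ((u, v) \<in> parcs (K G H) \<longleftrightarrow> (h_proj u v (p1 @ p2) = h_proj u v ?q) = c)"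
    if "u \<in> pverts G \<union> pverts H" "v \<in> pverts G \<union> pverts H" "u \<noteq> v" for u v
  proof -
    \<comment> \<open>Non-membership in the other part is recorded too: it lets the projection erase
      a foreign block, and it rules out arcs of that part because arcs have both ends among its
      vertices.\<close>
    consider "u \<in> pverts G" "u \<notin> pverts H" "v \<in> pverts G" "v \<notin> pverts H"
      | "u \<in> pverts H" "u \<notin> pverts G" "v \<in> pverts H" "v \<notin> pverts G"
      | "u \<in> pverts G" "u \<notin> pverts H" "v \<in> pverts H" "v \<notin> pverts G"
      | "u \<in> pverts H" "u \<notin> pverts G" "v \<in> pverts G" "v \<notin> pverts H"
      using \<open>u \<in> _\<close> \<open>v \<in> _\<close> disj by blast
    then show ?thesis
    proof cases
      case 1
      then have "h_proj u v (p1 @ p2) = h_proj u v p1" "h_proj u v ?q = h_proj u v q1"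
        using sets by (simp_all add: h_proj_append h_proj_notin)
      moreover have "(u, v) \<in> parcs (K G H) \<longleftrightarrow> (u, v) \<in> parcs G"
        using 1 arcs by (auto simp: K_def graph_join_def disjoint_union_def)
      ultimately show ?thesis
        using G 1 \<open>u \<noteq> v\<close> by (simp add: realizes_def)
    next
      case 2
      then have "h_proj u v (p1 @ p2) = h_proj u v p2" "h_proj u v ?q = h_proj u v q2"
        using sets by (simp_all add: h_proj_append h_proj_notin)
      moreover have "(u, v) \<in> parcs (K G H) \<longleftrightarrow> (u, v) \<in> parcs H"
        using 2 arcs by (auto simp: K_def graph_join_def disjoint_union_def)
      ultimately show ?thesis
        using H 2 \<open>u \<noteq> v\<close> by (simp add: realizes_def)
    next
      case 3
      \<comment> \<open>Each block contains one of the two letters exactly once, so only the order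
        of the blocks matters.\<close>
      then have "h_proj u v (p1 @ p2) = [0,1]" "h_proj u v ?q = (if a = c then [0,1] else [1,0])"
        using sets by (simp_all add: h_proj_append h_proj_fst h_proj_snd)
      moreover have "(u, v) \<in> parcs (K G H) \<longleftrightarrow> a"
        using 3 arcs by (auto simp: K_def graph_join_def disjoint_union_def)
      ultimately show ?thesis by auto
    next
      case 4
      then have "h_proj u v (p1 @ p2) = [1,0]" "h_proj u v ?q = (if a = c then [1,0] else [0,1])"
        using sets by (simp_all add: h_proj_append h_proj_fst h_proj_snd)
      moreover have "(u, v) \<in> parcs (K G H) \<longleftrightarrow> a"
        using 4 arcs by (auto simp: K_def graph_join_def disjoint_union_def)
      ultimately show ?thesis by auto
    qed
  qed
  then show ?thesis
    using sets disj unfolding realizes_def verts by auto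
qed

lemma cograph_realizable: "cograph G \<Longrightarrow> \<exists>p q. realizes c p q G"
proof (induction rule: cograph.induct)
  case (single v)
  \<comment> \<open>There are no two distinct vertices to compare, so either encoding works.\<close>
  have "realizes c [v] [v] \<lparr>pverts = {v}, parcs = {}\<rparr>"
    by (simp add: realizes_def)
  then show ?case by blast
next
  case (union G H)
  then show ?case
    using realizes_combine[OF union.hyps, of c _ _ _ _ False] by (simp only: if_False) blast
next
  case (join G H)
  then show ?case
    using realizes_combine[OF join.hyps, of c _ _ _ _ True] by (simp only: if_True) blast
qed

text \<open>Each ordering projects to \<open>[0,1]\<close> or \<open>[1,0]\<close>, so only four
  words can arise: two from agreement and two from disagreement. The vertices themselves serve as
  letters, hence equality rather than isomorphism.\<close>

lemma word_graph_realizes: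
  assumes "cograph G" "realizes c p q G"
    and "[0,1,0,1] \<in> L \<longleftrightarrow> c" "[1,0,1,0] \<in> L \<longleftrightarrow> c"
    and "[0,1,1,0] \<in> L \<longleftrightarrow> \<not> c" "[1,0,0,1] \<in> L \<longleftrightarrow> \<not> c"
  shows "word_graph L (p @ q) = G"
proof -
  have "(u, v) \<in> parcs G \<longleftrightarrow> h_proj u v (p @ q) \<in> L"
    if "u \<in> pverts G" "v \<in> pverts G" "u \<noteq> v" for u v
  proof -
    have "h_proj u v p \<in> {[0,1], [1,0]}" "h_proj u v q \<in> {[0,1], [1,0]}"
      and "(u, v) \<in> parcs G \<longleftrightarrow> (h_proj u v p = h_proj u v q) = c"
      using assms(2) that by (auto simp: realizes_def)
    then show ?thesis
      using assms(3-6) by (auto simp: h_proj_append)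
  qed
  then have "parcs G =
      {(u, v). u \<in> pverts G \<and> v \<in> pverts G \<and> u \<noteq> v \<and> h_proj u v (p @ q) \<in> L}"
    using cograph_arcs[OF assms(1)] by blast
  moreover have "set (p @ q) = pverts G"
    using assms(2) by (simp add: realizes_def)
  ultimately show ?thesis
    unfolding word_graph_def by simp
qed

text \<open>Needed because \<open>representable\<close> asks for a word over \<open>nat\<close>,
  whereas the word built from a cograph has its vertices as letters.\<close>

lemma word_graph_map_iso:
  assumes "inj_on f (set w)"
  shows "digraph_iso (with_proj (word_graph L w)) (with_proj (word_graph L (map f w)))"
proof -
  let ?hom = "\<lparr>iso_verts = f, iso_arcs = map_prod f f, iso_head = snd, iso_tail = fst\<rparr>"
  let ?G = "with_proj (word_graph L w)"
  have "wf_digraph ?G"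
    by unfold_locales (auto simp: word_graph_def)
  moreover have "inj_on (map_prod f f) (arcs ?G)"
    by (rule inj_on_subset[OF map_prod_inj_on[OF assms assms]]) (auto simp: word_graph_def)
  ultimately have "pre_digraph.digraph_isomorphism ?G ?hom"
    using assms by (simp add: pre_digraph.digraph_isomorphism_def word_graph_def)
  moreover have "parcs (word_graph L (map f w)) = map_prod f f ` parcs (word_graph L w)"
  proof -
    have "h_proj (f u) (f v) (map f w) = h_proj u v w \<and> (f u = f v \<longleftrightarrow> u = v)"
      if "u \<in> set w" "v \<in> set w" for u v
      using h_proj_map[OF assms that] inj_on_eq_iff[OF assms that] by simp
    then have "(f u, f v) \<in> parcs (word_graph L (map f w)) \<longleftrightarrow> (u, v) \<in> parcs (word_graph L w)"
      if "u \<in> set w" "v \<in> set w" for u v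
      using that by (simp add: word_graph_def)
    \<comment> \<open>With these bounds every arc on either side has the form just compared, so the
      pointwise equivalence gives equality of sets.\<close>
    moreover have "parcs (word_graph L (map f w)) \<subseteq> f ` set w \<times> f ` set w"
      "parcs (word_graph L w) \<subseteq> set w \<times> set w"
      by (auto simp: word_graph_def)
    ultimately show ?thesis
      by (fastforce simp: map_prod_def)
  qed
  then have "with_proj (word_graph L (map f w)) = app_iso ?hom ?G"
    by (simp add: app_iso_def with_proj_def) (simp add: word_graph_def)
  ultimately show ?thesis
    unfolding digraph_iso_def by blast
qed

lemma word_graph_representable:
  assumes "w \<noteq> []"
  shows "representable L (word_graph L w)"
proof -
  obtain f :: "'a \<Rightarrow> nat" where "inj_on f (set w)"
    using finite_imp_inj_to_nat_seg[of "set w"] by auto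
  then show ?thesis
    using word_graph_map_iso[of f w L] assms unfolding representable_def
    by (intro exI[of _ "map f w"]) simp
qed

theorem mainTheorem3:
  fixes L :: "bit list set"
  assumes "symmetric01 L"
    and "([1,0,0,1] \<in> L \<and> [0,1,1,0] \<in> L) \<or> ([1,0,1,0] \<in> L \<and> [0,1,0,1] \<in> L)"
    and "\<not> ([1,0,0,1] \<in> L \<and> [0,1,1,0] \<in> L \<and> [1,0,1,0] \<in> L \<and> [0,1,0,1] \<in> L)"
  shows "{G :: 'a pair_pre_digraph. cograph G} \<subseteq> represented_graphs L"
proof
  fix G :: "'a pair_pre_digraph"
  assume "G \<in> {G. cograph G}"
  then have G: "cograph G" by simp
  \<comment> \<open>Symmetry puts \<open>[0,1,0,1]\<close> on the same side as
    \<open>[1,0,1,0]\<close>, and the hypotheses then put both disagreement words on the opposite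
    side.\<close>
  define c where "c \<longleftrightarrow> [1,0,1,0] \<in> L"
  obtain p q where pq: "realizes c p q G"
    using cograph_realizable[OF G] by blast
  have flip: "flip w \<in> L" if "w \<in> L" for w
    using assms(1) that unfolding symmetric01_def by blast
  have "[0,1,0,1] \<in> L \<longleftrightarrow> [1,0,1,0] \<in> L" "[0,1,1,0] \<in> L \<longleftrightarrow> [1,0,0,1] \<in> L"
    using flip[of "[0,1,0,1]"] flip[of "[1,0,1,0]"] flip[of "[0,1,1,0]"] flip[of "[1,0,0,1]"]
    by (auto simp: flip_def)
  then have "word_graph L (p @ q) = G"
    using assms(2,3) by (intro word_graph_realizes[OF G pq]) (auto simp: c_def)
  moreover have "p @ q \<noteq> []"
    using pq cograph_pair_graph[OF G] by (auto simp: realizes_def)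
  ultimately show "G \<in> represented_graphs L"
    using word_graph_representable[of "p @ q" L] by (simp add: represented_graphs_def)
qed

end
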